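(* Let $W^L$ and $W^R$ be two states at relaxation equilibrium satisfying some hydrostatic equilibrium $$u^L=u^R=0,\qquad \rho^{L}=\rho_{hs}^{L},\ \rho^R=\rho_{hs}^R,\qquad p^{L}=p_{hs}^{L},\ p^R=p_{hs}^R,$$ with $\rho_{hs}^{L,R}$ and $p_{hs}^{L,R}$ given hydrostatic states. If the function $\bar\rho$ is defined by $$\bar\rho(W^L,W^R)=\tfrac12(\rho^L+\rho^R)$$ and the difference $Z^R-Z^L$ of the gravitational potential in the intermediate states of the approximate Riemann solver is approximated (replaced) by $$Z^R-Z^L\approx-\frac{p_{hs}^R-p_{hs}^L}{\frac12(\rho_{hs}^L+\rho_{hs}^R)},$$ then the approximate Riemann solver $W_{\mathcal R}$ preserves the steady state, i.e. $W_{\mathcal R}(x/t;W^L,W^R)=W^L$ if $x/t<0$ and $=W^R$ if $x/t>0$.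
   Context: States are $W=(\rho,\rho u,E,\rho\pi,\rho v,\rho Z,a,b)$ with $\rho>0$, $e>0$, where $E=\rho e+\frac12M^2\rho u^2$, $M>0$ is the Mach number, $\tau=1/\rho$, $p=p(\tau,e)$ is the pressure law, and $a\ge b>0$ are relaxation speeds. A state is at relaxation equilibrium if $\pi=p(\tau,e)$, $v=u$, $Z=\Phi$ with $\Phi$ the given gravitational potential. Approximate Riemann solver. For $\alpha\in\{L,R\}$ and $\Delta=\bar\rho(W^L,W^R)\,(Z^R-Z^L)$, the intermediate states are $v^*=\frac{Mb^Lv^L+Mb^Rv^R+\pi^L-\pi^R-\Delta}{M(b^L+b^R)}$ (the $v$-component of both $W^{L*}$ and $W^{R*}$), $\frac1{\rho^{L*}}=\frac1{\rho^L}+\frac{Mb^R(v^R-v^L)+\pi^L-\pi^R-\Delta}{a^L(b^L+b^R)}$, $\frac1{\rho^{R*}}=\frac1{\rho^R}+\frac{Mb^L(v^R-v^L)+\pi^R-\pi^L+\Delta}{a^R(b^L+b^R)}$, $u^{L*}=u^L+\frac{b^L(Mb^R(v^R-v^L)+\pi^L-\pi^R-\Delta)}{Ma^L(b^L+b^R)}$, $u^{R*}=u^R+\frac{b^R(Mb^L(v^L-v^R)+\pi^L-\pi^R-\Delta)}{Ma^R(b^L+b^R)}$, $\pi^{L*}=\frac{b^R\pi^L+b^L\pi^R+Mb^Lb^R(v^L-v^R)+b^L\Delta}{b^L+b^R}$, $\pi^{R*}=\frac{b^R\pi^L+b^L\pi^R+Mb^Lb^R(v^L-v^R)-b^R\Delta}{b^L+b^R}$,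 $e^{\alpha*}=e^\alpha+\frac{(\pi^{\alpha*})^2-(\pi^\alpha)^2}{2a^\alpha b^\alpha}+\frac{M^2[(v^*-u^{\alpha*})^2-(v^\alpha-u^\alpha)^2]}{2(a^\alpha/b^\alpha-1)}$ (last quotient read as $0$ if $a^\alpha=b^\alpha$), $a^{\alpha*}=a^\alpha$, $b^{\alpha*}=b^\alpha$, $Z^{\alpha*}=Z^\alpha$. With $\sigma^-=v^L-\frac{a^L}{M\rho^L}$, $\sigma^v=v^*$, $\sigma^+=v^R+\frac{a^R}{M\rho^R}$, the solver $W_{\mathcal R}(x/t;W^L,W^R)$ equals $W^L$ for $x/t<\sigma^-$, $W^{L*}$ for $\sigma^-<x/t<\sigma^v$, $W^{R*}$ for $\sigma^v<x/t<\sigma^+$, and $W^R$ for $x/t>\sigma^+$. *)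

theory Defs
  imports Complex_Main
begin

record state =
  rho :: real
  rho_u :: real
  En :: real
  rho_pi :: real
  rho_v :: real
  rho_Z :: real
  spd_a :: real
  spd_b :: real

definition tau :: "state \<Rightarrow> real" where
  "tau W = 1 / rho W"

definition vel_u :: "state \<Rightarrow> real" where
  "vel_u W = rho_u W / rho W"

definition relax_pi :: "state \<Rightarrow> real" where
  "relax_pi W = rho_pi W / rho W"

definition relax_v :: "state \<Rightarrow> real" where
  "relax_v W = rho_v W / rho W"

definition relax_Z :: "state \<Rightarrow> real" where
  "relax_Z W = rho_Z W / rho W"

text \<open>Specific internal energy: \<open>En = rho e + M^2 rho u^2 / 2\<close> solved for \<open>e\<close>.\<close>

definition int_e :: "real \<Rightarrow> state \<Rightarrow> real" where
  "int_e M W = (En W - 1/2 * M\<^sup>2 * rho W * (vel_u W)\<^sup>2) / rho W"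

definition state_of_prim ::
  "real \<Rightarrow> real \<Rightarrow> real \<Rightarrow> real \<Rightarrow> real \<Rightarrow> real \<Rightarrow> real \<Rightarrow> real \<Rightarrow> real \<Rightarrow> state" where
  "state_of_prim M r u e \<pi> v Z a b =
     \<lparr> rho = r, rho_u = r * u, En = r * e + 1/2 * M\<^sup>2 * r * u\<^sup>2,
       rho_pi = r * \<pi>, rho_v = r * v, rho_Z = r * Z, spd_a = a, spd_b = b \<rparr>"

definition admissible :: "real \<Rightarrow> state \<Rightarrow> bool" where
  "admissible M W \<longleftrightarrow> rho W > 0 \<and> int_e M W > 0 \<and> spd_a W \<ge> spd_b W \<and> spd_b W > 0"

definition pressure :: "(real \<Rightarrow> real \<Rightarrow> real) \<Rightarrow> real \<Rightarrow> state \<Rightarrow> real" where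
  "pressure p M W = p (tau W) (int_e M W)"

text \<open>Relaxation equilibrium of a state located at position \<open>x\<close>, for the pressure law \<open>p\<close>
  and the gravitational potential \<open>\<Phi>\<close>.\<close>

definition relax_equilibrium ::
  "(real \<Rightarrow> real \<Rightarrow> real) \<Rightarrow> (real \<Rightarrow> real) \<Rightarrow> real \<Rightarrow> real \<Rightarrow> state \<Rightarrow> bool" where
  "relax_equilibrium p \<Phi> M x W \<longleftrightarrow>
     relax_pi W = pressure p M W \<and> relax_v W = vel_u W \<and> relax_Z W = \<Phi> x"

definition satisfies_hydrostatic ::
  "(real \<Rightarrow> real \<Rightarrow> real) \<Rightarrow> real \<Rightarrow> real \<Rightarrow> real \<Rightarrow> state \<Rightarrow> bool" where
  "satisfies_hydrostatic p M rho_hs p_hs W \<longleftrightarrow>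
     vel_u W = 0 \<and> rho W = rho_hs \<and> pressure p M W = p_hs"

text \<open>In the intermediate states the jump of the potential occurs only in the source
  \<open>\<Delta> = rhobar WL WR * dZ\<close>. It is kept as a parameter \<open>dZ\<close>: the choice
  \<open>dZ = relax_Z WR - relax_Z WL\<close> gives the solver with the exact jump, other values
  the solver with an approximated one.\<close>

definition source_Delta ::
  "(state \<Rightarrow> state \<Rightarrow> real) \<Rightarrow> real \<Rightarrow> state \<Rightarrow> state \<Rightarrow> real" where
  "source_Delta rhobar dZ WL WR = rhobar WL WR * dZ"

definition v_star :: "real \<Rightarrow> real \<Rightarrow> state \<Rightarrow> state \<Rightarrow> real" where
  "v_star M \<Delta> WL WR =
     (M * spd_b WL * relax_v WL + M * spd_b WR * relax_v WR + relax_pi WL - relax_pi WR - \<Delta>)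
     / (M * (spd_b WL + spd_b WR))"

definition rho_Lstar :: "real \<Rightarrow> real \<Rightarrow> state \<Rightarrow> state \<Rightarrow> real" where
  "rho_Lstar M \<Delta> WL WR =
     1 / (1 / rho WL
          + (M * spd_b WR * (relax_v WR - relax_v WL) + relax_pi WL - relax_pi WR - \<Delta>)
            / (spd_a WL * (spd_b WL + spd_b WR)))"

definition rho_Rstar :: "real \<Rightarrow> real \<Rightarrow> state \<Rightarrow> state \<Rightarrow> real" where
  "rho_Rstar M \<Delta> WL WR =
     1 / (1 / rho WR
          + (M * spd_b WL * (relax_v WR - relax_v WL) + relax_pi WR - relax_pi WL + \<Delta>)
            / (spd_a WR * (spd_b WL + spd_b WR)))"

definition u_Lstar :: "real \<Rightarrow> real \<Rightarrow> state \<Rightarrow> state \<Rightarrow> real" where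
  "u_Lstar M \<Delta> WL WR =
     vel_u WL
     + spd_b WL * (M * spd_b WR * (relax_v WR - relax_v WL) + relax_pi WL - relax_pi WR - \<Delta>)
       / (M * spd_a WL * (spd_b WL + spd_b WR))"

definition u_Rstar :: "real \<Rightarrow> real \<Rightarrow> state \<Rightarrow> state \<Rightarrow> real" where
  "u_Rstar M \<Delta> WL WR =
     vel_u WR
     + spd_b WR * (M * spd_b WL * (relax_v WL - relax_v WR) + relax_pi WL - relax_pi WR - \<Delta>)
       / (M * spd_a WR * (spd_b WL + spd_b WR))"

definition pi_Lstar :: "real \<Rightarrow> real \<Rightarrow> state \<Rightarrow> state \<Rightarrow> real" where
  "pi_Lstar M \<Delta> WL WR =
     (spd_b WR * relax_pi WL + spd_b WL * relax_pi WR
      + M * spd_b WL * spd_b WR * (relax_v WL - relax_v WR) + spd_b WL * \<Delta>)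
     / (spd_b WL + spd_b WR)"

definition pi_Rstar :: "real \<Rightarrow> real \<Rightarrow> state \<Rightarrow> state \<Rightarrow> real" where
  "pi_Rstar M \<Delta> WL WR =
     (spd_b WR * relax_pi WL + spd_b WL * relax_pi WR
      + M * spd_b WL * spd_b WR * (relax_v WL - relax_v WR) - spd_b WR * \<Delta>)
     / (spd_b WL + spd_b WR)"

definition e_star :: "real \<Rightarrow> real \<Rightarrow> real \<Rightarrow> real \<Rightarrow> state \<Rightarrow> real" where
  "e_star M vstar ustar pistar W =
     int_e M W
     + (pistar\<^sup>2 - (relax_pi W)\<^sup>2) / (2 * spd_a W * spd_b W)
     + (if spd_a W = spd_b W then 0
        else M\<^sup>2 * ((vstar - ustar)\<^sup>2 - (relax_v W - vel_u W)\<^sup>2)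
             / (2 * (spd_a W / spd_b W - 1)))"

definition W_Lstar :: "real \<Rightarrow> real \<Rightarrow> state \<Rightarrow> state \<Rightarrow> state" where
  "W_Lstar M \<Delta> WL WR =
     (let vs = v_star M \<Delta> WL WR; us = u_Lstar M \<Delta> WL WR; ps = pi_Lstar M \<Delta> WL WR
      in state_of_prim M (rho_Lstar M \<Delta> WL WR) us (e_star M vs us ps WL) ps vs
           (relax_Z WL) (spd_a WL) (spd_b WL))"

definition W_Rstar :: "real \<Rightarrow> real \<Rightarrow> state \<Rightarrow> state \<Rightarrow> state" where
  "W_Rstar M \<Delta> WL WR =
     (let vs = v_star M \<Delta> WL WR; us = u_Rstar M \<Delta> WL WR; ps = pi_Rstar M \<Delta> WL WR
      in state_of_prim M (rho_Rstar M \<Delta> WL WR) us (e_star M vs us ps WR) ps vs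
           (relax_Z WR) (spd_a WR) (spd_b WR))"

definition sigma_minus :: "real \<Rightarrow> state \<Rightarrow> real" where
  "sigma_minus M WL = relax_v WL - spd_a WL / (M * rho WL)"

definition sigma_plus :: "real \<Rightarrow> state \<Rightarrow> real" where
  "sigma_plus M WR = relax_v WR + spd_a WR / (M * rho WR)"

text \<open>The solver is prescribed only strictly between the wave speeds. At a wave speed itself
  it is given here the value of the state to its right.\<close>

definition riemann_solver ::
  "real \<Rightarrow> (state \<Rightarrow> state \<Rightarrow> real) \<Rightarrow> real \<Rightarrow> real \<Rightarrow> state \<Rightarrow> state \<Rightarrow> state" where
  "riemann_solver M rhobar dZ \<xi> WL WR =
     (let \<Delta> = source_Delta rhobar dZ WL WR
      in if \<xi> < sigma_minus M WL then WL
         else if \<xi> < v_star M \<Delta> WL WR then W_Lstar M \<Delta> WL WR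
         else if \<xi> < sigma_plus M WR then W_Rstar M \<Delta> WL WR
         else WR)"

definition rho_mean :: "state \<Rightarrow> state \<Rightarrow> real" where
  "rho_mean WL WR = 1/2 * (rho WL + rho WR)"

end

theory Submission
  imports Defs
begin

text \<open>With the prescribed jump the source is \<open>\<Delta> = \<pi>\<^sup>L - \<pi>\<^sup>R\<close>, and since also \<open>v\<^sup>L = v\<^sup>R\<close> every
  correction term in the intermediate states vanishes. Thus \<open>W\<^sup>L\<^sup>* = W\<^sup>L\<close> and \<open>W\<^sup>R\<^sup>* = W\<^sup>R\<close>, and
  the two states are separated by the middle wave alone, whose speed is \<open>v\<^sup>* = 0\<close>.\<close>

text \<open>This turns agreement of the primitive variables into equality of states; each was
  obtained by dividing by the density.\<close>

lemma state_of_prim_components: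
  assumes "rho W \<noteq> 0"
  shows "state_of_prim M (rho W) (vel_u W) (int_e M W) (relax_pi W) (relax_v W) (relax_Z W)
           (spd_a W) (spd_b W) = W"
  using assms
  by (cases W) (simp add: state_of_prim_def vel_u_def int_e_def relax_pi_def relax_v_def relax_Z_def)

text \<open>Both differences of squares vanish, so the two branches of the \<open>if\<close>
  agree.\<close>

lemma e_star_unchanged: "e_star M (relax_v W) (vel_u W) (relax_pi W) W = int_e M W"
  by (simp add: e_star_def)

text \<open>Once the source cancels the pressure jump, \<open>v_star\<close> is the mean of the two
  velocities weighted by \<open>spd_b\<close>.\<close>

lemma v_star_balanced:
  assumes "M \<noteq> 0" and "spd_b WL + spd_b WR \<noteq> 0" and "relax_v WL = v" and "relax_v WR = v"
  shows "v_star M (relax_pi WL - relax_pi WR) WL WR = v"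
  using assms by (simp add: v_star_def divide_simps) (simp add: algebra_simps)

lemma W_Lstar_balanced:
  assumes "M \<noteq> 0" and "spd_b WL + spd_b WR \<noteq> 0" and "relax_v WR = relax_v WL" and "rho WL \<noteq> 0"
  shows "W_Lstar M (relax_pi WL - relax_pi WR) WL WR = WL"
proof -
  let ?D = "relax_pi WL - relax_pi WR"
  have "v_star M ?D WL WR = relax_v WL"
    using assms by (intro v_star_balanced) auto
  moreover have "rho_Lstar M ?D WL WR = rho WL" and "u_Lstar M ?D WL WR = vel_u WL"
    using assms by (simp_all add: rho_Lstar_def u_Lstar_def)
  \<comment> \<open>The source term exchanges \<open>relax_pi WR\<close> for
    \<open>relax_pi WL\<close>, leaving a mean of equal values.\<close>
  moreover have "pi_Lstar M ?D WL WR = relax_pi WL"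
    using assms by (simp add: pi_Lstar_def divide_simps) (simp add: algebra_simps)
  ultimately show ?thesis
    using assms by (simp add: W_Lstar_def e_star_unchanged state_of_prim_components)
qed

lemma W_Rstar_balanced:
  assumes "M \<noteq> 0" and "spd_b WL + spd_b WR \<noteq> 0" and "relax_v WL = relax_v WR" and "rho WR \<noteq> 0"
  shows "W_Rstar M (relax_pi WL - relax_pi WR) WL WR = WR"
proof -
  let ?D = "relax_pi WL - relax_pi WR"
  have "v_star M ?D WL WR = relax_v WR"
    using assms by (intro v_star_balanced) auto
  moreover have "rho_Rstar M ?D WL WR = rho WR" and "u_Rstar M ?D WL WR = vel_u WR"
    using assms by (simp_all add: rho_Rstar_def u_Rstar_def)
  \<comment> \<open>Here the source enters with the opposite sign and weight
    \<open>spd_b WR\<close>, so it exchanges \<open>relax_pi WL\<close> for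
    \<open>relax_pi WR\<close>.\<close>
  moreover have "pi_Rstar M ?D WL WR = relax_pi WR"
    using assms by (simp add: pi_Rstar_def divide_simps) (simp add: algebra_simps)
  ultimately show ?thesis
    using assms by (simp add: W_Rstar_def e_star_unchanged state_of_prim_components)
qed

theorem lemma16:
  fixes M :: real
    and p :: "real \<Rightarrow> real \<Rightarrow> real"
    and \<Phi> :: "real \<Rightarrow> real"
    and xL xR :: real
    and WL WR :: state
    and rho_hsL rho_hsR p_hsL p_hsR :: real
    and x t :: real
  assumes "M > 0"
    and "admissible M WL" and "admissible M WR"
    and "relax_equilibrium p \<Phi> M xL WL" and "relax_equilibrium p \<Phi> M xR WR"
    and "satisfies_hydrostatic p M rho_hsL p_hsL WL"
    and "satisfies_hydrostatic p M rho_hsR p_hsR WR"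
    and "t > 0"
  shows "(x / t < 0 \<longrightarrow>
           riemann_solver M rho_mean (- ((p_hsR - p_hsL) / (1/2 * (rho_hsL + rho_hsR)))) (x / t) WL WR = WL)
       \<and> (x / t > 0 \<longrightarrow>
           riemann_solver M rho_mean (- ((p_hsR - p_hsL) / (1/2 * (rho_hsL + rho_hsR)))) (x / t) WL WR = WR)"
proof -
  let ?dZ = "- ((p_hsR - p_hsL) / (1/2 * (rho_hsL + rho_hsR)))"
  have pos: "rho WL > 0" "rho WR > 0" "spd_b WL > 0" "spd_b WR > 0"
    using assms(2,3) by (auto simp: admissible_def)
  have hs: "rho WL = rho_hsL" "rho WR = rho_hsR" "relax_pi WL = p_hsL" "relax_pi WR = p_hsR"
    and rest: "relax_v WL = 0" "relax_v WR = 0"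
    using assms(4-7) by (simp_all add: relax_equilibrium_def satisfies_hydrostatic_def)
  \<comment> \<open>\<open>rho_mean\<close> equals the denominator of \<open>?dZ\<close>, as the
    densities are the hydrostatic ones, and cancels it.\<close>
  have source: "source_Delta rho_mean ?dZ WL WR = relax_pi WL - relax_pi WR"
    using pos unfolding source_Delta_def rho_mean_def hs by (simp add: divide_simps) (simp add: algebra_simps)
  have nz: "M \<noteq> 0" "spd_b WL + spd_b WR \<noteq> 0" "rho WL \<noteq> 0" "rho WR \<noteq> 0"
    using assms(1) pos by auto
  have "v_star M (relax_pi WL - relax_pi WR) WL WR = 0"
    using nz rest by (intro v_star_balanced) auto
  moreover have "W_Lstar M (relax_pi WL - relax_pi WR) WL WR = WL"
    using nz rest by (intro W_Lstar_balanced) auto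
  moreover have "W_Rstar M (relax_pi WL - relax_pi WR) WL WR = WR"
    using nz rest by (intro W_Rstar_balanced) auto
  \<comment> \<open>This keeps positive \<open>x / t\<close> out of the first branch; beyond the
    middle wave at speed 0 the solver only returns \<open>WR\<close>.\<close>
  moreover have "sigma_minus M WL \<le> 0"
    using assms(1,2) rest by (auto simp: sigma_minus_def admissible_def)
  ultimately show ?thesis
    unfolding riemann_solver_def Let_def source by auto
qed

end
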